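(* Let $\Omega=\prod_{k=1}^n\Omega_k$ with product probability measure $\mu=\bigotimes_{k=1}^n\mu_k$, and let $f$ be a bounded measurable real function on $\Omega$. Let $t>0$ and denote $$W=\left\Vert\sum_{k=1}^nE_k\bigl[(f-\inf_kf)^2\bigr]\right\Vert_\infty .$$ Then $$\Pr\{E[f]-f>t\}\le\exp\left(\frac{-t^2}{2W}\right).$$
   Context: $E[g]=\int_\Omega g\,\mathrm{d}\mu$, $\Pr$ is probability under $\mu$, and $\Vert\cdot\Vert_\infty$ is the norm of $L_\infty[\mu]$. For $\mathbf{x}\in\Omega$ and $y\in\Omega_k$, $\mathbf{x}_{y,k}$ denotes $\mathbf{x}$ with its $k$th coordinate replaced by $y$. Then $E_k[g](\mathbf{x})=\int_{\Omega_k}g(\mathbf{x}_{y,k})\,\mathrm{d}\mu_k(y)$ and $(\inf_kg)(\mathbf{x})=\inf_{y\in\Omega_k}g(\mathbf{x}_{y,k})$. Measurability questions are ignored: the functions $\inf_kf$ are assumed measurable. If $W=0$ the right-hand side is read as $0$. *)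

theory Defs
  imports "HOL-Probability.Probability"
begin

text \<open>
  Points of the product space are functions in the extensional product
  \<^term>\<open>space (PiM I M)\<close>, and \<^term>\<open>x(k := y)\<close> is the point \<^term>\<open>x\<close> with its
  \<^term>\<open>k\<close>-th coordinate replaced by \<^term>\<open>y\<close>.
\<close>

definition coord_expectation ::
  "('i \<Rightarrow> 'a measure) \<Rightarrow> 'i \<Rightarrow> (('i \<Rightarrow> 'a) \<Rightarrow> real) \<Rightarrow> ('i \<Rightarrow> 'a) \<Rightarrow> real" where
  "coord_expectation M k g x = (LINT y|M k. g (x(k := y)))"

definition coord_inf ::
  "('i \<Rightarrow> 'a measure) \<Rightarrow> 'i \<Rightarrow> (('i \<Rightarrow> 'a) \<Rightarrow> real) \<Rightarrow> ('i \<Rightarrow> 'a) \<Rightarrow> real" where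
  "coord_inf M k g x = (INF y\<in>space (M k). g (x(k := y)))"

text \<open>
  The essential supremum is taken in \<^typ>\<open>ereal\<close>, since \<^const>\<open>esssup\<close> needs a complete
  linear order. The conversion to \<^typ>\<open>real\<close> loses nothing when \<^term>\<open>g\<close> is measurable and
  essentially bounded and the measure is a probability measure; it would send an infinite
  norm to 0.
\<close>

definition Linf_norm :: "'a measure \<Rightarrow> ('a \<Rightarrow> real) \<Rightarrow> real" where
  "Linf_norm M g = real_of_ereal (esssup M (\<lambda>x. ereal \<bar>g x\<bar>))"

end

theory Submission
  imports Defs "HOL-Real_Asymp.Real_Asymp"
begin

text \<open>
  Entropy method for \<open>F = exp (b (E f - f))\<close>. Up to a factor constant in the coordinate \<open>k\<close>,
  \<open>F\<close> is \<open>exp (- b h)\<close> with \<open>h = f - inf\<^sub>k f \<ge> 0\<close>. Since \<open>h\<^sup>2\<close> increases and \<open>exp (- b h)\<close> decreases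
  in \<open>h\<close>, the tilted second moment of \<open>h\<close> is at most the untilted one, so the entropy of \<open>F\<close> in the
  coordinate \<open>k\<close> is at most \<open>b\<^sup>2 / 2 \<cdot> E\<^sub>k (h\<^sup>2) \<cdot> E\<^sub>k F\<close>. Because \<open>E\<^sub>k (h\<^sup>2)\<close> does not depend on
  that coordinate, subadditivity of entropy gives \<open>Ent F \<le> b\<^sup>2 / 2 \<cdot> W \<cdot> E F\<close>. Herbst's argument
  turns this into \<open>E F \<le> exp (b\<^sup>2 W / 2)\<close>, and Markov's inequality with \<open>b = t / W\<close>
  (\<open>b \<rightarrow> \<infinity>\<close> if \<open>W = 0\<close>) finishes.
\<close>

section \<open>Bounded measurable functions\<close>

text \<open>The bound is required at every point, not just almost everywhere, so that it passes to
  every section of a function on the product.\<close>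

definition bdd_meas :: "'a measure \<Rightarrow> ('a \<Rightarrow> real) \<Rightarrow> bool" where
  "bdd_meas M f \<longleftrightarrow> f \<in> borel_measurable M \<and> (\<exists>B. \<forall>x\<in>space M. \<bar>f x\<bar> \<le> B)"

text \<open>A lower bound away from 0 keeps \<open>ln F\<close> bounded as well, so every term of an
  entropy is integrable.\<close>

definition pos_bdd_meas :: "'a measure \<Rightarrow> ('a \<Rightarrow> real) \<Rightarrow> bool" where
  "pos_bdd_meas M f \<longleftrightarrow> bdd_meas M f \<and> (\<exists>a>0. \<forall>x\<in>space M. a \<le> f x)"

lemma bdd_measI:
  assumes "f \<in> borel_measurable M" "\<And>x. x \<in> space M \<Longrightarrow> \<bar>f x\<bar> \<le> B"
  shows "bdd_meas M f"
  using assms unfolding bdd_meas_def by blast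

lemma bdd_meas_measurable: "bdd_meas M f \<Longrightarrow> f \<in> borel_measurable M"
  by (simp add: bdd_meas_def)

lemma bdd_measE:
  assumes "bdd_meas M f"
  obtains B where "B > 0" "\<And>x. x \<in> space M \<Longrightarrow> \<bar>f x\<bar> \<le> B"
proof -
  obtain B where "\<forall>x\<in>space M. \<bar>f x\<bar> \<le> B" using assms by (auto simp: bdd_meas_def)
  then have "max B 1 > 0" "\<And>x. x \<in> space M \<Longrightarrow> \<bar>f x\<bar> \<le> max B 1" by auto
  then show ?thesis using that by blast
qed

lemma bdd_meas_const [simp]: "bdd_meas M (\<lambda>x. c)"
  by (rule bdd_measI[where B="\<bar>c\<bar>"]) auto

lemma bdd_meas_add:
  assumes "bdd_meas M f" "bdd_meas M g"
  shows "bdd_meas M (\<lambda>x. f x + g x)"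
proof -
  obtain B C where "\<And>x. x \<in> space M \<Longrightarrow> \<bar>f x\<bar> \<le> B" "\<And>x. x \<in> space M \<Longrightarrow> \<bar>g x\<bar> \<le> C"
    using assms by (metis bdd_measE)
  then have "\<And>x. x \<in> space M \<Longrightarrow> \<bar>f x + g x\<bar> \<le> B + C"
    by (smt (verit))
  then show ?thesis
    by (intro bdd_measI borel_measurable_add assms[THEN bdd_meas_measurable])
qed

lemma bdd_meas_mult:
  assumes "bdd_meas M f" "bdd_meas M g"
  shows "bdd_meas M (\<lambda>x. f x * g x)"
proof -
  obtain B C where "B > 0" "\<And>x. x \<in> space M \<Longrightarrow> \<bar>f x\<bar> \<le> B" "\<And>x. x \<in> space M \<Longrightarrow> \<bar>g x\<bar> \<le> C"
    using assms by (metis bdd_measE)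
  then have "\<And>x. x \<in> space M \<Longrightarrow> \<bar>f x * g x\<bar> \<le> B * C"
    by (simp add: abs_mult mult_mono)
  then show ?thesis
    by (intro bdd_measI borel_measurable_times assms[THEN bdd_meas_measurable])
qed

lemma bdd_meas_minus: "bdd_meas M f \<Longrightarrow> bdd_meas M (\<lambda>x. - f x)"
  using bdd_meas_mult[OF bdd_meas_const[of M "- 1"], of f] by simp

lemma bdd_meas_diff:
  "bdd_meas M f \<Longrightarrow> bdd_meas M g \<Longrightarrow> bdd_meas M (\<lambda>x. f x - g x)"
  using bdd_meas_add[of M f "\<lambda>x. - g x"] bdd_meas_minus[of M g] by simp

lemma bdd_meas_power: "bdd_meas M f \<Longrightarrow> bdd_meas M (\<lambda>x. f x ^ m)"
  by (induction m) (auto intro!: bdd_meas_const bdd_meas_mult)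

lemma bdd_meas_sum:
  "(\<And>i. i \<in> J \<Longrightarrow> bdd_meas M (f i)) \<Longrightarrow> bdd_meas M (\<lambda>x. \<Sum>i\<in>J. f i x)"
  by (induction J rule: infinite_finite_induct) (auto intro!: bdd_meas_const bdd_meas_add)

lemma pos_bdd_meas_bdd: "pos_bdd_meas M f \<Longrightarrow> bdd_meas M f"
  by (simp add: pos_bdd_meas_def)

lemma pos_bdd_meas_pos: "pos_bdd_meas M f \<Longrightarrow> x \<in> space M \<Longrightarrow> f x > 0"
  by (force simp: pos_bdd_meas_def)

lemma pos_bdd_meas_exp:
  assumes "bdd_meas M f"
  shows "pos_bdd_meas M (\<lambda>x. exp (f x))"
proof -
  obtain B where B: "\<And>x. x \<in> space M \<Longrightarrow> \<bar>f x\<bar> \<le> B" using assms by (metis bdd_measE)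
  have "bdd_meas M (\<lambda>x. exp (f x))"
    using assms B by (intro bdd_measI[where B="exp B"]) (auto dest: bdd_meas_measurable B)
  moreover have "\<forall>x\<in>space M. exp (- B) \<le> exp (f x)" using B by (force simp: abs_le_iff)
  ultimately show ?thesis unfolding pos_bdd_meas_def by (meson exp_gt_zero)
qed

lemma bdd_meas_exp: "bdd_meas M f \<Longrightarrow> bdd_meas M (\<lambda>x. exp (f x))"
  by (rule pos_bdd_meas_bdd[OF pos_bdd_meas_exp])

lemma bdd_meas_ln:
  assumes "pos_bdd_meas M f"
  shows "bdd_meas M (\<lambda>x. ln (f x))"
proof -
  obtain a where a: "a > 0" "\<And>x. x \<in> space M \<Longrightarrow> a \<le> f x"
    using assms by (auto simp: pos_bdd_meas_def)
  obtain B where B: "\<And>x. x \<in> space M \<Longrightarrow> \<bar>f x\<bar> \<le> B"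
    using assms by (metis bdd_measE pos_bdd_meas_bdd)
  show ?thesis
  proof (rule bdd_measI[where B="\<bar>ln a\<bar> + \<bar>ln B\<bar>"])
    show "(\<lambda>x. ln (f x)) \<in> borel_measurable M"
      using assms by (auto dest!: pos_bdd_meas_bdd bdd_meas_measurable)
    fix x assume x: "x \<in> space M"
    have "ln a \<le> ln (f x)" "ln (f x) \<le> ln B"
      using a B[OF x] a(2)[OF x] by (auto intro!: ln_mono)
    then show "\<bar>ln (f x)\<bar> \<le> \<bar>ln a\<bar> + \<bar>ln B\<bar>" by linarith
  qed
qed

lemmas bdd_meas_intros = bdd_meas_const bdd_meas_add bdd_meas_mult bdd_meas_minus bdd_meas_diff
  bdd_meas_power bdd_meas_exp bdd_meas_ln pos_bdd_meas_exp

lemma pos_bdd_meas_divide: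
  assumes "pos_bdd_meas M f" "pos_bdd_meas M g"
  shows "pos_bdd_meas M (\<lambda>x. f x / g x)"
proof -
  \<comment> \<open>On the space the quotient is the exponential of a difference of bounded
    logarithms, which gives both of its bounds at once.\<close>
  have "pos_bdd_meas M (\<lambda>x. exp (ln (f x) - ln (g x)))"
    using assms by (intro bdd_meas_intros)
  moreover have "exp (ln (f x) - ln (g x)) = f x / g x" if "x \<in> space M" for x
    using assms that by (simp add: exp_diff pos_bdd_meas_pos)
  ultimately show ?thesis
    unfolding pos_bdd_meas_def bdd_meas_def by (simp cong: measurable_cong)
qed

section \<open>Integrals of bounded functions over a probability space\<close>

context prob_space
begin

lemma integrable_bdd_meas: "bdd_meas M f \<Longrightarrow> integrable M f"
  by (metis bdd_measE bdd_meas_measurable integrable_const_bound AE_I2 real_norm_def)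

lemma abs_integral_le:
  assumes "bdd_meas M f" "\<And>x. x \<in> space M \<Longrightarrow> \<bar>f x\<bar> \<le> B"
  shows "\<bar>LINT x|M. f x\<bar> \<le> B"
proof -
  have "\<bar>LINT x|M. f x\<bar> \<le> (LINT x|M. \<bar>f x\<bar>)" by (rule integral_abs_bound)
  also have "\<dots> \<le> (LINT x|M. B)"
    using assms by (intro integral_mono integrable_abs[OF integrable_bdd_meas]) auto
  finally show ?thesis by (simp add: prob_space)
qed

lemma integral_ge_lower_bound:
  assumes "bdd_meas M f" "\<And>x. x \<in> space M \<Longrightarrow> a \<le> f x"
  shows "a \<le> (LINT x|M. f x)"
  using integral_mono[of M "\<lambda>_. a" f] assms by (simp add: integrable_bdd_meas prob_space)

lemma integral_pos_bdd_meas: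
  assumes "pos_bdd_meas M f"
  shows "0 < (LINT x|M. f x)"
  using assms integral_ge_lower_bound unfolding pos_bdd_meas_def by (meson less_le_trans)

end

section \<open>Entropy\<close>

definition fun_entropy :: "'a measure \<Rightarrow> ('a \<Rightarrow> real) \<Rightarrow> real" where
  "fun_entropy M F = (LINT x|M. F x * ln (F x)) - (LINT x|M. F x) * ln (LINT x|M. F x)"

text \<open>One half of the variational formula for entropy. With \<open>m = E F\<close>, the
  inequality \<open>ln r \<le> r - 1\<close> is taken at \<open>r = m * G / F\<close>, multiplied by
  \<open>F\<close> and integrated; the right-hand side \<open>m * G - F\<close> has mean 0 because
  \<open>G\<close> has mean 1.\<close>

lemma (in prob_space) integral_mult_ln_le_fun_entropy:
  assumes F: "pos_bdd_meas M F" and G: "pos_bdd_meas M G" and G1: "(LINT x|M. G x) = 1"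
  shows "(LINT x|M. F x * ln (G x)) \<le> fun_entropy M F"
proof -
  let ?m = "LINT x|M. F x"
  have m: "?m > 0" using F by (rule integral_pos_bdd_meas)
  have bF: "bdd_meas M F" "bdd_meas M (\<lambda>x. F x * ln (F x))" "bdd_meas M (\<lambda>x. F x * ln (G x))"
      "bdd_meas M G"
    by (intro bdd_meas_intros F G pos_bdd_meas_bdd[OF F] pos_bdd_meas_bdd[OF G])+
  note i = bF[THEN integrable_bdd_meas]
  have "(LINT x|M. F x * ln (G x) - F x * ln (F x) + ln ?m * F x) \<le> (LINT x|M. ?m * G x - F x)"
  proof (rule integral_mono)
    show "integrable M (\<lambda>x. F x * ln (G x) - F x * ln (F x) + ln ?m * F x)"
      "integrable M (\<lambda>x. ?m * G x - F x)"
      by (intro Bochner_Integration.integrable_add Bochner_Integration.integrable_diff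
          integrable_mult_right i)+
    fix x assume x: "x \<in> space M"
    note p = pos_bdd_meas_pos[OF F x] pos_bdd_meas_pos[OF G x]
    have "ln (?m * G x / F x) \<le> ?m * G x / F x - 1"
      using p m by (intro ln_le_minus_one) auto
    then have "F x * ln (?m * G x / F x) \<le> F x * (?m * G x / F x - 1)"
      using p by (intro mult_left_mono) auto
    also have "\<dots> = ?m * G x - F x" using p by (simp add: field_simps)
    also have "ln (?m * G x / F x) = ln ?m + ln (G x) - ln (F x)"
      using p m by (simp add: ln_div ln_mult)
    finally show "F x * ln (G x) - F x * ln (F x) + ln ?m * F x \<le> ?m * G x - F x"
      by (simp add: algebra_simps)
  qed
  moreover have "(LINT x|M. F x * ln (G x) - F x * ln (F x) + ln ?m * F x)
      = (LINT x|M. F x * ln (G x)) - (LINT x|M. F x * ln (F x)) + ln ?m * ?m"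
    using i by simp
  moreover have "(LINT x|M. ?m * G x - F x) = 0"
    using i G1 by simp
  ultimately show ?thesis by (simp add: fun_entropy_def algebra_simps)
qed

section \<open>Exponential moments\<close>

text \<open>Taylor's formula with Lagrange remainder. The bound is uniform for bounded
  \<open>z\<close>, which justifies differentiation under the integral below.\<close>

lemma exp_second_order_bound:
  fixes z :: real
  shows "\<bar>exp z - 1 - z\<bar> \<le> z\<^sup>2 * exp \<bar>z\<bar>"
proof -
  obtain t where t: "\<bar>t\<bar> \<le> \<bar>z\<bar>" "exp z = (\<Sum>m<2. z ^ m / fact m) + (exp t / fact 2) * z ^ 2"
    using Maclaurin_exp_le[of z 2] by auto
  have "exp z - 1 - z = exp t / 2 * z\<^sup>2"
    using t(2) by (simp add: numeral_2_eq_2)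
  moreover have "exp t / 2 * z\<^sup>2 \<le> exp \<bar>z\<bar> * z\<^sup>2"
  proof (rule mult_right_mono)
    have "exp t \<le> exp \<bar>z\<bar>" using t(1) by simp
    then show "exp t / 2 \<le> exp \<bar>z\<bar>" using exp_gt_zero[of t] by linarith
  qed simp
  moreover have "0 \<le> exp t / 2 * z\<^sup>2" by simp
  ultimately show ?thesis by (metis abs_of_nonneg mult.commute)
qed

text \<open>The weight \<open>v\<close> allows repeated use: \<open>v = 1\<close> gives the first
  derivative of the exponential moment, \<open>v = u\<close> the second. The difference quotient
  misses the claimed derivative by at most a constant times the increment.\<close>

lemma (in prob_space) exponential_moment_has_derivative:
  assumes u: "bdd_meas M u" and v: "bdd_meas M v"
  shows "((\<lambda>s. LINT x|M. v x * exp (s * u x)) has_real_derivative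
    (LINT x|M. v x * u x * exp (r * u x))) (at r)"
proof -
  obtain B where B: "B > 0" "\<And>x. x \<in> space M \<Longrightarrow> \<bar>u x\<bar> \<le> B" using u by (metis bdd_measE)
  obtain C where C: "C > 0" "\<And>x. x \<in> space M \<Longrightarrow> \<bar>v x\<bar> \<le> C" using v by (metis bdd_measE)
  \<comment> \<open>The factors bound \<open>v\<close>, \<open>exp (r * u)\<close> and, after
    division by \<open>h\<^sup>2\<close>, the Taylor remainder at \<open>h * u\<close> for
    increments with \<open>\<bar>h\<bar> \<le> 1\<close>.\<close>
  define K where "K = C * exp (\<bar>r\<bar> * B) * (B\<^sup>2 * exp B)"
  let ?Z = "\<lambda>s. LINT x|M. v x * exp (s * u x)" and ?D = "LINT x|M. v x * u x * exp (r * u x)"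
  have bd: "\<bar>(?Z (r + h) - ?Z r) / h - ?D\<bar> \<le> K * \<bar>h\<bar>" if h: "h \<noteq> 0" "\<bar>h\<bar> \<le> 1" for h
  proof -
    let ?e = "\<lambda>x. v x * exp (r * u x) * (exp (h * u x) - 1 - h * u x)"
    have bv: "bdd_meas M (\<lambda>x. v x * exp (s * u x))" "bdd_meas M (\<lambda>x. v x * u x * exp (s * u x))"
      "bdd_meas M ?e" for s
      using u v by (auto intro!: bdd_meas_intros)
    have "?e = (\<lambda>x. v x * exp ((r + h) * u x) - v x * exp (r * u x) - h * (v x * u x * exp (r * u x)))"
      by (simp add: algebra_simps exp_add fun_eq_iff)
    then have "(LINT x|M. ?e x) = ?Z (r + h) - ?Z r - h * ?D"
      using bv by (simp add: integrable_bdd_meas bdd_meas_diff)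
    moreover have "\<bar>LINT x|M. ?e x\<bar> \<le> K * h\<^sup>2"
    proof (rule abs_integral_le[OF bv(3)])
      fix x assume x: "x \<in> space M"
      have mu: "\<bar>c * u x\<bar> \<le> \<bar>c\<bar> * B" for c
        using B(2)[OF x] by (simp add: abs_mult mult_left_mono)
      have hB: "\<bar>h\<bar> * B \<le> B" using B(1) h by (intro mult_left_le_one_le) auto
      note hu = mu[of h] order_trans[OF mu[of h] hB] order_trans[OF abs_ge_self mu[of r]]
      have "\<bar>exp (h * u x) - 1 - h * u x\<bar> \<le> (h * u x)\<^sup>2 * exp \<bar>h * u x\<bar>"
        by (rule exp_second_order_bound)
      also have "\<dots> \<le> (\<bar>h\<bar> * B)\<^sup>2 * exp B"
        using hu by (intro mult_mono) (auto intro: abs_le_square_iff[THEN iffD1])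
      finally have "\<bar>exp (h * u x) - 1 - h * u x\<bar> \<le> (B\<^sup>2 * exp B) * h\<^sup>2"
        by (simp add: power_mult_distrib mult_ac)
      then have "\<bar>v x\<bar> * exp (r * u x) * \<bar>exp (h * u x) - 1 - h * u x\<bar>
          \<le> C * exp (\<bar>r\<bar> * B) * ((B\<^sup>2 * exp B) * h\<^sup>2)"
        using C(1) C(2)[OF x] hu by (intro mult_mono) auto
      then show "\<bar>?e x\<bar> \<le> K * h\<^sup>2" by (simp add: K_def abs_mult mult_ac)
    qed
    ultimately have *: "\<bar>?Z (r + h) - ?Z r - h * ?D\<bar> \<le> K * h\<^sup>2" by simp
    have "(?Z (r + h) - ?Z r) / h - ?D = (?Z (r + h) - ?Z r - h * ?D) / h"
      using h by (simp add: diff_divide_distrib)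
    then have "\<bar>(?Z (r + h) - ?Z r) / h - ?D\<bar> = \<bar>?Z (r + h) - ?Z r - h * ?D\<bar> / \<bar>h\<bar>"
      by simp
    also have "\<dots> \<le> K * h\<^sup>2 / \<bar>h\<bar>" using * by (rule divide_right_mono) auto
    also have "\<dots> = K * \<bar>h\<bar>" using h by (cases "h > 0") (auto simp: power2_eq_square)
    finally show ?thesis .
  qed
  have "((\<lambda>h. (?Z (r + h) - ?Z r) / h - ?D) \<longlongrightarrow> 0) (at 0)"
  proof (rule Lim_null_comparison)
    show "\<forall>\<^sub>F h in at 0. norm ((?Z (r + h) - ?Z r) / h - ?D) \<le> K * \<bar>h\<bar>"
      unfolding eventually_at by (rule exI[of _ 1]) (auto intro!: bd simp: dist_real_def)
    show "((\<lambda>h. K * \<bar>h\<bar>) \<longlongrightarrow> 0) (at 0)" by (auto intro!: tendsto_eq_intros)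
  qed
  then show ?thesis unfolding DERIV_def using LIM_zero_iff by blast
qed

text \<open>Both factors are compared with their values at the point where \<open>h\<^sup>2\<close> equals its mean.\<close>

lemma (in prob_space) integral_square_exp_le:
  assumes h: "bdd_meas M h" "\<And>x. x \<in> space M \<Longrightarrow> 0 \<le> h x" and s: "s \<ge> 0"
  shows "(LINT x|M. (h x)\<^sup>2 * exp (- s * h x)) \<le> (LINT x|M. (h x)\<^sup>2) * (LINT x|M. exp (- s * h x))"
proof -
  define a where "a = (LINT x|M. (h x)\<^sup>2)"
  define e where "e = exp (- s * sqrt a)"
  have a: "a \<ge> 0" by (simp add: a_def)
  have b: "bdd_meas M (\<lambda>x. (h x)\<^sup>2 * exp (- s * h x))" "bdd_meas M (\<lambda>x. exp (- s * h x))"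
    "bdd_meas M (\<lambda>x. (h x)\<^sup>2)"
    using h by (auto intro!: bdd_meas_intros)
  have "(LINT x|M. (h x)\<^sup>2 * exp (- s * h x) - a * exp (- s * h x)) \<le> (LINT x|M. e * (h x)\<^sup>2 - e * a)"
  proof (rule integral_mono)
    fix x assume x: "x \<in> space M"
    \<comment> \<open>The two factors have opposite signs, changing together where \<open>h\<close>
      crosses \<open>sqrt a\<close>.\<close>
    have "((h x)\<^sup>2 - a) * (exp (- s * h x) - e) \<le> 0"
    proof (cases "h x \<le> sqrt a")
      case True
      then have "(h x)\<^sup>2 \<le> a" using h(2)[OF x] a by (metis power_mono real_sqrt_pow2)
      moreover have "e \<le> exp (- s * h x)" using True s by (simp add: e_def mult_left_mono)
      ultimately show ?thesis by (simp add: mult_nonpos_nonneg)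
    next
      case False
      then have "a \<le> (h x)\<^sup>2" using a
        by (metis less_eq_real_def linorder_not_le power_mono real_sqrt_ge_zero real_sqrt_pow2)
      moreover have "exp (- s * h x) \<le> e" using False s by (simp add: e_def mult_left_mono)
      ultimately show ?thesis by (simp add: mult_nonneg_nonpos)
    qed
    then show "(h x)\<^sup>2 * exp (- s * h x) - a * exp (- s * h x) \<le> e * (h x)\<^sup>2 - e * a"
      by (simp add: algebra_simps)
  qed (use b in \<open>auto intro!: integrable_bdd_meas bdd_meas_diff bdd_meas_mult\<close>)
  also have "\<dots> = e * a - e * a"
    using b by (subst Bochner_Integration.integral_diff) (auto intro!: integrable_bdd_meas simp: a_def prob_space)
  finally show ?thesis
    using b by (simp add: integrable_bdd_meas a_def)
qed

text \<open>
  With \<open>Z s = \<integral> exp (- s h)\<close> the normalised entropy of \<open>exp (- s h)\<close> is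
  \<open>s (ln Z)' - ln Z\<close>, whose derivative is \<open>s (ln Z)''\<close>.
\<close>

lemma (in prob_space) fun_entropy_exp_le:
  assumes h: "bdd_meas M h" "\<And>x. x \<in> space M \<Longrightarrow> 0 \<le> h x" and b: "b \<ge> 0"
  shows "fun_entropy M (\<lambda>x. exp (- b * h x))
    \<le> b\<^sup>2 / 2 * (LINT x|M. (h x)\<^sup>2) * (LINT x|M. exp (- b * h x))"
proof -
  define Z where "Z s = (LINT x|M. exp (- s * h x))" for s
  define Z1 where "Z1 s = (LINT x|M. - h x * exp (- s * h x))" for s
  define Z2 where "Z2 s = (LINT x|M. (h x)\<^sup>2 * exp (- s * h x))" for s
  define V where "V = (LINT x|M. (h x)\<^sup>2)"
  have mh: "bdd_meas M (\<lambda>x. - h x)" using h by (intro bdd_meas_intros)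
  have Zpos: "Z s > 0" for s
    unfolding Z_def using h by (intro integral_pos_bdd_meas bdd_meas_intros)
  have dZ: "(Z has_real_derivative Z1 s) (at s)" for s
    using exponential_moment_has_derivative[OF mh bdd_meas_const, of 1 s]
    by (simp add: Z_def[abs_def] Z1_def)
  have dZ1: "(Z1 has_real_derivative Z2 s) (at s)" for s
    using exponential_moment_has_derivative[OF mh mh, of s]
    by (simp add: Z1_def[abs_def] Z2_def power2_eq_square)
  \<comment> \<open>\<open>q\<close> is the gap between the two sides of the claim divided by
    \<open>Z s\<close>. It vanishes at 0, where \<open>Z = 1\<close>, so it suffices that it is
    nondecreasing.\<close>
  define q where "q s = s\<^sup>2 / 2 * V - (s * (Z1 s / Z s) - ln (Z s))" for s
  have dq: "(q has_real_derivative s * V - s * ((Z2 s * Z s - Z1 s * Z1 s) / (Z s * Z s))) (at s)" for s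
    unfolding q_def[abs_def] using Zpos[of s]
    by (auto intro!: derivative_eq_intros dZ dZ1 simp: field_simps)
  have "q 0 \<le> q b"
  proof (rule DERIV_nonneg_imp_nondecreasing[OF b, where f=q])
    fix s assume s: "0 \<le> s" "s \<le> b"
    \<comment> \<open>The second derivative of \<open>ln Z\<close> is a variance under the tilted
      measure. Dropping the squared mean leaves the tilted second moment, which is at most
      \<open>V\<close>.\<close>
    have "Z2 s * Z s - Z1 s * Z1 s \<le> Z2 s * Z s" by simp
    also have "\<dots> \<le> V * Z s * Z s"
      using integral_square_exp_le[OF h s(1)] Zpos[of s]
      by (intro mult_right_mono) (auto simp: Z2_def V_def Z_def)
    finally have "(Z2 s * Z s - Z1 s * Z1 s) / (Z s * Z s) \<le> V"
      using Zpos[of s] by (simp add: field_simps)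
    then have "s * ((Z2 s * Z s - Z1 s * Z1 s) / (Z s * Z s)) \<le> s * V"
      using s by (intro mult_left_mono) auto
    then show "\<exists>y. (q has_real_derivative y) (at s) \<and> 0 \<le> y"
      using dq[of s] by (metis diff_ge_0_iff_ge)
  qed
  moreover have "q 0 = 0" by (simp add: q_def Z_def prob_space)
  ultimately have "b * (Z1 b / Z b) - ln (Z b) \<le> b\<^sup>2 / 2 * V" by (simp add: q_def)
  then have "(b * (Z1 b / Z b) - ln (Z b)) * Z b \<le> b\<^sup>2 / 2 * V * Z b"
    using Zpos[of b] by (intro mult_right_mono) auto
  moreover have "(b * (Z1 b / Z b) - ln (Z b)) * Z b = b * Z1 b - Z b * ln (Z b)"
    using Zpos[of b] by (simp add: field_simps)
  moreover have "(LINT x|M. exp (- b * h x) * ln (exp (- b * h x))) = b * Z1 b"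
    unfolding Z1_def integral_mult_right_zero[symmetric]
    by (rule Bochner_Integration.integral_cong) (auto simp: algebra_simps)
  ultimately show ?thesis by (simp add: fun_entropy_def Z_def V_def)
qed

text \<open>Herbst's argument: \<open>ln Z s / s - s W / 2\<close> is nonincreasing and tends to the mean of \<open>u\<close> at \<open>0\<close>.\<close>

lemma (in prob_space) herbst:
  assumes u: "bdd_meas M u"
    and ent: "\<And>s. s > 0 \<Longrightarrow>
      fun_entropy M (\<lambda>x. exp (s * u x)) \<le> s\<^sup>2 / 2 * W * (LINT x|M. exp (s * u x))"
    and b: "b > 0"
  shows "(LINT x|M. exp (b * u x)) \<le> exp (b * (LINT x|M. u x) + b\<^sup>2 / 2 * W)"
proof -
  define Z where "Z s = (LINT x|M. exp (s * u x))" for s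
  define Z1 where "Z1 s = (LINT x|M. u x * exp (s * u x))" for s
  define E where "E = (LINT x|M. u x)"
  have Zpos: "Z s > 0" for s
    unfolding Z_def using u by (intro integral_pos_bdd_meas bdd_meas_intros)
  have dZ: "(Z has_real_derivative Z1 s) (at s)" for s
    using exponential_moment_has_derivative[OF u bdd_meas_const, of 1 s]
    by (simp add: Z_def[abs_def] Z1_def)
  have ent': "s * Z1 s - Z s * ln (Z s) \<le> s\<^sup>2 / 2 * W * Z s" if "s > 0" for s
  proof -
    have "(LINT x|M. exp (s * u x) * ln (exp (s * u x))) = s * Z1 s"
      unfolding Z1_def integral_mult_right_zero[symmetric]
      by (rule Bochner_Integration.integral_cong) (auto simp: algebra_simps)
    then show ?thesis using ent[OF that] by (simp add: fun_entropy_def Z_def)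
  qed
  define q where "q s = ln (Z s) / s - s / 2 * W" for s
  have dq: "(q has_real_derivative (Z1 s / Z s * s - ln (Z s)) / (s * s) - W / 2) (at s)"
    if "s > 0" for s
    unfolding q_def[abs_def] using Zpos[of s] that
    by (auto intro!: derivative_eq_intros dZ simp: field_simps)
  have mono: "q b \<le> q r" if r: "0 < r" "r < b" for r
  proof (rule DERIV_nonpos_imp_nonincreasing[where f=q])
    show "r \<le> b" using r by simp
    fix s assume s: "r \<le> s" "s \<le> b"
    then have s0: "s > 0" using r by linarith
    \<comment> \<open>Divided by \<open>Z s\<close> and by \<open>s * s\<close>, the entropy bound
      says exactly that the derivative of \<open>q\<close> is nonpositive.\<close>
    have "(s * Z1 s - Z s * ln (Z s)) / Z s \<le> s\<^sup>2 / 2 * W * Z s / Z s"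
      using ent'[OF s0] Zpos[of s] by (intro divide_right_mono) auto
    then have "Z1 s / Z s * s - ln (Z s) \<le> W / 2 * (s * s)"
      using Zpos[of s] by (simp add: field_simps power2_eq_square)
    then have "(Z1 s / Z s * s - ln (Z s)) / (s * s) \<le> W / 2"
      using s0 by (simp add: pos_divide_le_eq)
    then show "\<exists>y. (q has_real_derivative y) (at s) \<and> y \<le> 0"
      using dq[OF s0] by (metis diff_le_0_iff_le)
  qed
  have Z0: "Z 0 = 1" "Z1 0 = E" by (simp_all add: Z_def Z1_def E_def prob_space)
  \<comment> \<open>Since \<open>ln (Z 0) = 0\<close>, the quotient \<open>ln (Z s) / s\<close> is
    the difference quotient of \<open>ln Z\<close> at 0. Only its limit from the right is needed,
    because \<open>q\<close> is controlled for positive arguments.\<close>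
  have "((\<lambda>s. ln (Z s)) has_real_derivative E) (at 0)"
    using Zpos[of 0] by (auto intro!: derivative_eq_intros dZ simp: Z0)
  then have "((\<lambda>s. ln (Z s) / s) \<longlongrightarrow> E) (at 0)" by (simp add: DERIV_def Z0)
  then have lim: "((\<lambda>s. ln (Z s) / s) \<longlongrightarrow> E) (at_right 0)"
    by (rule tendsto_mono[OF at_le, rotated]) auto
  have "(q \<longlongrightarrow> E) (at_right 0)"
    unfolding q_def[abs_def] by (rule tendsto_eq_rhs[OF tendsto_diff[OF lim]])
      (auto intro!: tendsto_eq_intros)
  moreover have "\<forall>\<^sub>F r in at_right 0. q b \<le> q r"
    using b mono unfolding eventually_at_right_field by blast
  ultimately have "q b \<le> E" by (intro tendsto_lowerbound) auto
  then have "ln (Z b) / b \<le> E + b / 2 * W" by (simp add: q_def)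
  then have "ln (Z b) \<le> b * E + b\<^sup>2 / 2 * W"
    using b by (simp add: field_simps power2_eq_square)
  then show ?thesis using Zpos[of b] by (metis E_def Z_def exp_le_cancel_iff exp_ln)
qed

section \<open>Tensorization of entropy\<close>

text \<open>Independence is pointwise rather than up to null sets, so that independence of all
  coordinates forces a constant.\<close>

definition coord_indep :: "'i set \<Rightarrow> ('i \<Rightarrow> 'a measure) \<Rightarrow> 'i \<Rightarrow> (('i \<Rightarrow> 'a) \<Rightarrow> real) \<Rightarrow> bool" where
  "coord_indep I M k g \<longleftrightarrow> (\<forall>x\<in>space (PiM I M). \<forall>y\<in>space (M k). g (x(k := y)) = g x)"

section \<open>Replacement of coordinates, partial expectations and Fubini on a finite
  product\<close>

locale finite_prob_product =
  fixes I :: "'i set" and M :: "'i \<Rightarrow> 'a measure"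
  assumes finite_I: "finite I" and prob_M: "\<And>k. k \<in> I \<Longrightarrow> prob_space (M k)"

sublocale finite_prob_product \<subseteq> prob_space "PiM I M"
  by (rule prob_space_PiM) (rule prob_M)

context finite_prob_product
begin

lemma upd_space:
  "x \<in> space (PiM I M) \<Longrightarrow> k \<in> I \<Longrightarrow> y \<in> space (M k) \<Longrightarrow> x(k := y) \<in> space (PiM I M)"
  by (auto simp: space_PiM PiE_iff extensional_def)

lemma measurable_upd:
  assumes "k \<in> I"
  shows "(\<lambda>(x, y). x(k := y)) \<in> measurable (PiM I M \<Otimes>\<^sub>M M k) (PiM I M)"
  \<comment> \<open>Replacing a coordinate already in \<open>I\<close> is the insertion map with
    \<open>insert k I = I\<close>.\<close>
  using measurable_add_dim[where I=I and M=M and i=k] assms by (simp add: insert_absorb)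

lemma bdd_meas_section:
  assumes F: "bdd_meas (PiM I M) F" and k: "k \<in> I" and x: "x \<in> space (PiM I M)"
  shows "bdd_meas (M k) (\<lambda>y. F (x(k := y)))"
proof -
  obtain B where B: "\<And>x. x \<in> space (PiM I M) \<Longrightarrow> \<bar>F x\<bar> \<le> B" using F by (metis bdd_measE)
  have "(\<lambda>y. x(k := y)) \<in> measurable (M k) (PiM I M)"
    using measurable_compose[OF measurable_Pair1'[OF x] measurable_upd[OF k]] by simp
  then show ?thesis
    using F B x k upd_space
    by (intro bdd_measI[where B=B]) (auto dest: bdd_meas_measurable intro: measurable_compose)
qed

lemma pos_bdd_meas_section:
  assumes "pos_bdd_meas (PiM I M) F" "k \<in> I" "x \<in> space (PiM I M)"
  shows "pos_bdd_meas (M k) (\<lambda>y. F (x(k := y)))"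
proof -
  obtain a where a: "a > 0" "\<And>x. x \<in> space (PiM I M) \<Longrightarrow> a \<le> F x"
    using assms(1) by (auto simp: pos_bdd_meas_def)
  then have "\<forall>y\<in>space (M k). a \<le> F (x(k := y))" using assms upd_space by blast
  then show ?thesis
    using a bdd_meas_section[OF pos_bdd_meas_bdd[OF assms(1)] assms(2,3)]
    unfolding pos_bdd_meas_def by blast
qed

lemma bdd_meas_coord_expectation:
  assumes F: "bdd_meas (PiM I M) F" and k: "k \<in> I"
  shows "bdd_meas (PiM I M) (coord_expectation M k F)"
proof -
  interpret k: prob_space "M k" by (rule prob_M[OF k])
  obtain B where B: "\<And>x. x \<in> space (PiM I M) \<Longrightarrow> \<bar>F x\<bar> \<le> B" using F by (metis bdd_measE)
  have "(\<lambda>z. F (case z of (x, y) \<Rightarrow> x(k := y))) \<in> borel_measurable (PiM I M \<Otimes>\<^sub>M M k)"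
    by (rule measurable_compose[OF measurable_upd[OF k] bdd_meas_measurable[OF F]])
  then have "coord_expectation M k F \<in> borel_measurable (PiM I M)"
    unfolding coord_expectation_def[abs_def]
    by (intro k.borel_measurable_lebesgue_integral) (simp add: case_prod_unfold)
  then show ?thesis
    using F B k upd_space
    by (intro bdd_measI[where B=B])
      (auto simp: coord_expectation_def intro!: k.abs_integral_le bdd_meas_section)
qed

lemma pos_bdd_meas_coord_expectation:
  assumes F: "pos_bdd_meas (PiM I M) F" and k: "k \<in> I"
  shows "pos_bdd_meas (PiM I M) (coord_expectation M k F)"
proof -
  interpret k: prob_space "M k" by (rule prob_M[OF k])
  obtain a where a: "a > 0" "\<And>x. x \<in> space (PiM I M) \<Longrightarrow> a \<le> F x"
    using F by (auto simp: pos_bdd_meas_def)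
  have "\<forall>x\<in>space (PiM I M). a \<le> coord_expectation M k F x"
    using a k upd_space pos_bdd_meas_bdd[OF F]
    by (auto simp: coord_expectation_def intro!: k.integral_ge_lower_bound bdd_meas_section)
  then show ?thesis
    using a bdd_meas_coord_expectation[OF pos_bdd_meas_bdd[OF F] k] unfolding pos_bdd_meas_def by blast
qed

lemma coord_indep_coord_expectation: "coord_indep I M k (coord_expectation M k F)"
  by (simp add: coord_indep_def coord_expectation_def)

text \<open>Updates at different coordinates commute, so averaging over \<open>k\<close> preserves
  independence of \<open>j\<close>. This permits averaging out the coordinates one after
  another.\<close>

lemma coord_indep_coord_expectation_other:
  assumes "coord_indep I M j F" "j \<in> I" "k \<in> I"
  shows "coord_indep I M j (coord_expectation M k F)"
proof (cases "j = k")
  case False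
  then have "F (x(j := y, k := z)) = F (x(k := z))"
    if "x \<in> space (PiM I M)" "y \<in> space (M j)" "z \<in> space (M k)" for x y z
    using assms(1) that upd_space[OF that(1) assms(3) that(3)] False
    by (simp add: fun_upd_twist[of j k] coord_indep_def)
  then show ?thesis
    by (auto simp: coord_indep_def coord_expectation_def intro!: Bochner_Integration.integral_cong)
qed (simp add: coord_indep_coord_expectation)

text \<open>Fubini: the product measure is the image of the product of \<open>M k\<close> with the
  remaining factors under insertion of coordinate \<open>k\<close>.\<close>

lemma integral_coord_split:
  assumes F: "bdd_meas (PiM I M) F" and k: "k \<in> I"
  shows "(LINT x|PiM I M. F x) = (LINT x|PiM (I - {k}) M. LINT y|M k. F (x(k := y)))"
proof -
  interpret k: prob_space "M k" by (rule prob_M[OF k])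
  interpret J: prob_space "PiM (I - {k}) M" by (rule prob_space_PiM) (auto intro: prob_M)
  interpret P: pair_prob_space "M k" "PiM (I - {k}) M" ..
  let ?u = "\<lambda>(y, x). x(k := y)"
  have ins: "insert k (I - {k}) = I" using k by auto
  have u: "?u \<in> measurable (M k \<Otimes>\<^sub>M PiM (I - {k}) M) (PiM I M)"
    using measurable_pair_swap[OF measurable_add_dim[where I="I - {k}" and M=M and i=k]]
    unfolding ins by (simp add: case_prod_unfold)
  have d: "distr (M k \<Otimes>\<^sub>M PiM (I - {k}) M) (PiM I M) ?u = PiM I M"
    using distr_pair_PiM_eq_PiM[of "I - {k}" M k] prob_M k unfolding ins by auto
  have i: "integrable (M k \<Otimes>\<^sub>M PiM (I - {k}) M) (\<lambda>z. F (?u z))"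
    by (rule integrable_distr[OF u]) (simp add: d integrable_bdd_meas F)
  have "(LINT x|PiM I M. F x) = (LINT z|(M k \<Otimes>\<^sub>M PiM (I - {k}) M). F (?u z))"
    using integral_distr[OF u bdd_meas_measurable[OF F]] by (simp add: d)
  also have "\<dots> = (LINT x|PiM (I - {k}) M. LINT y|M k. F (x(k := y)))"
    using P.integral_snd[of "\<lambda>y x. F (x(k := y))"] i by (simp add: case_prod_unfold)
  finally show ?thesis .
qed

text \<open>Once coordinate \<open>k\<close> is split off, the inner update overwrites the outer
  one, so the integrand is constant in \<open>y\<close> and total mass 1 removes that
  integral.\<close>

lemma integral_coord_expectation:
  assumes F: "bdd_meas (PiM I M) F" and k: "k \<in> I"
  shows "(LINT x|PiM I M. coord_expectation M k F x) = (LINT x|PiM I M. F x)"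
proof -
  interpret k: prob_space "M k" by (rule prob_M[OF k])
  have "(LINT x|PiM I M. coord_expectation M k F x)
      = (LINT x|PiM (I - {k}) M. LINT y|M k. LINT z|M k. F (x(k := z)))"
    using integral_coord_split[OF bdd_meas_coord_expectation[OF F k] k]
    by (simp only: coord_expectation_def fun_upd_upd)
  also have "\<dots> = (LINT x|PiM I M. F x)"
    unfolding integral_coord_split[OF F k] by (simp add: k.prob_space)
  finally show ?thesis .
qed

lemma coord_expectation_mult_indep:
  assumes "coord_indep I M k g" "x \<in> space (PiM I M)"
  shows "coord_expectation M k (\<lambda>z. g z * F z) x = g x * coord_expectation M k F x"
  unfolding coord_expectation_def integral_mult_right_zero[symmetric]
  using assms by (intro Bochner_Integration.integral_cong) (auto simp: coord_indep_def)

text \<open>A factor independent of coordinate \<open>k\<close> can be moved into the partial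
  expectation, which then disappears under the full integral.\<close>

lemma integral_mult_coord_expectation:
  assumes g: "bdd_meas (PiM I M) g" "coord_indep I M k g"
    and F: "bdd_meas (PiM I M) F" and k: "k \<in> I"
  shows "(LINT x|PiM I M. g x * coord_expectation M k F x) = (LINT x|PiM I M. g x * F x)"
proof -
  have "(LINT x|PiM I M. g x * coord_expectation M k F x)
      = (LINT x|PiM I M. coord_expectation M k (\<lambda>z. g z * F z) x)"
    by (rule Bochner_Integration.integral_cong) (simp_all add: coord_expectation_mult_indep g)
  also have "\<dots> = (LINT x|PiM I M. g x * F x)"
    using g F k by (intro integral_coord_expectation bdd_meas_intros)
  finally show ?thesis .
qed

text \<open>One point is turned into the other by changing one coordinate at a time, which ends
  because \<open>I\<close> is finite.\<close>

lemma coord_indep_all_imp_const: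
  assumes g: "\<And>k. k \<in> I \<Longrightarrow> coord_indep I M k g"
    and x: "x \<in> space (PiM I M)" and y: "y \<in> space (PiM I M)"
  shows "g x = g y"
proof -
  have "g (override_on x y J) = g x \<and> override_on x y J \<in> space (PiM I M)" if "J \<subseteq> I" for J
    using finite_subset[OF that finite_I] that
  proof (induction J)
    case empty
    then show ?case using x by simp
  next
    case (insert k J)
    have "override_on x y (insert k J) = (override_on x y J)(k := y k)"
      by (auto simp: override_on_def)
    moreover have "k \<in> I" "y k \<in> space (M k)" using y insert.prems by (auto simp: space_PiM)
    ultimately show ?case
      using insert.IH insert.prems g[of k] upd_space[of "override_on x y J" k "y k"]
      unfolding coord_indep_def by (metis insert_subset)
  qed
  \<comment> \<open>Outside \<open>I\<close> both points are \<open>undefined\<close>, by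
    extensionality.\<close>
  moreover have "override_on x y I = y"
    using x y by (auto simp: override_on_def space_PiM PiE_iff extensional_def fun_eq_iff)
  ultimately show ?thesis by (metis order_refl)
qed

section \<open>Subadditivity of entropy over the coordinates\<close>

definition coord_entropy :: "'i \<Rightarrow> (('i \<Rightarrow> 'a) \<Rightarrow> real) \<Rightarrow> ('i \<Rightarrow> 'a) \<Rightarrow> real" where
  "coord_entropy k F x = fun_entropy (M k) (\<lambda>y. F (x(k := y)))"

lemma bdd_meas_coord_entropy:
  assumes F: "pos_bdd_meas (PiM I M) F" and k: "k \<in> I"
  shows "bdd_meas (PiM I M) (coord_entropy k F)"
proof -
  let ?L = "\<lambda>x. F x * ln (F x)"
  have "coord_entropy k F
      = (\<lambda>x. coord_expectation M k ?L x - coord_expectation M k F x * ln (coord_expectation M k F x))"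
    by (simp add: fun_eq_iff coord_entropy_def fun_entropy_def coord_expectation_def)
  then show ?thesis
    by (simp only:) (intro bdd_meas_diff bdd_meas_mult bdd_meas_ln bdd_meas_coord_expectation
        pos_bdd_meas_coord_expectation pos_bdd_meas_bdd[OF F] F k)
qed

text \<open>
  The coordinates in \<open>J\<close> are averaged out of \<open>F\<close> one at a time. Since \<open>E\<^sub>k (G / E\<^sub>k G) = 1\<close>,
  passing from \<open>G\<close> to \<open>E\<^sub>k G\<close> costs at most the entropy of \<open>F\<close> in the coordinate \<open>k\<close>.
\<close>

lemma entropy_averaging:
  assumes F: "pos_bdd_meas (PiM I M) F" and J: "J \<subseteq> I"
  shows "\<exists>G. pos_bdd_meas (PiM I M) G \<and> (\<forall>k\<in>J. coord_indep I M k G) \<and>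
    (LINT x|PiM I M. G x) = (LINT x|PiM I M. F x) \<and>
    (LINT x|PiM I M. F x * ln (F x)) - (LINT x|PiM I M. F x * ln (G x))
      \<le> (\<Sum>k\<in>J. LINT x|PiM I M. coord_entropy k F x)"
  using finite_subset[OF J finite_I] J
proof (induction J)
  case empty
  show ?case using F by (intro exI[of _ F]) auto
next
  case (insert k J)
  then have k: "k \<in> I" by auto
  interpret k: prob_space "M k" by (rule prob_M[OF k])
  obtain G where G: "pos_bdd_meas (PiM I M) G" "\<And>j. j \<in> J \<Longrightarrow> coord_indep I M j G"
      "(LINT x|PiM I M. G x) = (LINT x|PiM I M. F x)"
      "(LINT x|PiM I M. F x * ln (F x)) - (LINT x|PiM I M. F x * ln (G x))
        \<le> (\<Sum>k\<in>J. LINT x|PiM I M. coord_entropy k F x)"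
    using insert by auto
  define G' where "G' = coord_expectation M k G"
  have G': "pos_bdd_meas (PiM I M) G'" "coord_indep I M k G'"
    unfolding G'_def using G k
    by (auto intro: pos_bdd_meas_coord_expectation coord_indep_coord_expectation)
  have bF: "bdd_meas (PiM I M) F" using F by (rule pos_bdd_meas_bdd)
  let ?R = "\<lambda>x. G x / G' x"
  have R: "pos_bdd_meas (PiM I M) ?R" using G G' by (intro pos_bdd_meas_divide)
  have FR: "bdd_meas (PiM I M) (\<lambda>x. F x * ln (?R x))"
    using bF R by (intro bdd_meas_intros)
  have "(LINT x|PiM I M. F x * ln (G x)) - (LINT x|PiM I M. F x * ln (G' x))
      = (LINT x|PiM I M. F x * ln (G x) - F x * ln (G' x))"
    using bF G G'
    by (intro Bochner_Integration.integral_diff[symmetric] integrable_bdd_meas bdd_meas_intros)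
  also have "\<dots> = (LINT x|PiM I M. F x * ln (?R x))"
  proof (rule Bochner_Integration.integral_cong)
    fix x assume x: "x \<in> space (PiM I M)"
    show "F x * ln (G x) - F x * ln (G' x) = F x * ln (?R x)"
      using pos_bdd_meas_pos[OF G(1) x] pos_bdd_meas_pos[OF G'(1) x]
      by (simp add: ln_div right_diff_distrib)
  qed simp
  also have "\<dots> = (LINT x|PiM I M. coord_expectation M k (\<lambda>x. F x * ln (?R x)) x)"
    using integral_coord_expectation[OF FR k] by simp
  also have "\<dots> \<le> (LINT x|PiM I M. coord_entropy k F x)"
  proof (rule integral_mono)
    fix x assume x: "x \<in> space (PiM I M)"
    \<comment> \<open>The ratio has mean 1 on the factor \<open>M k\<close>, so the variational
      bound applies there with \<open>?R\<close> in the role of \<open>G\<close>.\<close>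
    have "(LINT y|M k. ?R (x(k := y))) = (LINT y|M k. G (x(k := y)) / G' x)"
      using G'(2) x by (intro Bochner_Integration.integral_cong) (auto simp: coord_indep_def)
    also have "\<dots> = 1"
      using pos_bdd_meas_pos[OF G'(1) x] by (simp add: G'_def coord_expectation_def)
    finally show "coord_expectation M k (\<lambda>x. F x * ln (?R x)) x \<le> coord_entropy k F x"
      unfolding coord_expectation_def coord_entropy_def
      using F R k x by (intro k.integral_mult_ln_le_fun_entropy pos_bdd_meas_section)
  qed (use FR F k in \<open>auto intro!: integrable_bdd_meas bdd_meas_coord_expectation bdd_meas_coord_entropy\<close>)
  finally have "(LINT x|PiM I M. F x * ln (F x)) - (LINT x|PiM I M. F x * ln (G' x))
      \<le> (\<Sum>k\<in>insert k J. LINT x|PiM I M. coord_entropy k F x)"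
    using G(4) insert by simp
  moreover have "(LINT x|PiM I M. G' x) = (LINT x|PiM I M. F x)"
    using integral_coord_expectation[OF pos_bdd_meas_bdd[OF G(1)] k] G(3) by (simp add: G'_def)
  moreover have "\<forall>j\<in>insert k J. coord_indep I M j G'"
    using G(2) G'(2) insert.prems k
    by (auto simp: G'_def intro: coord_indep_coord_expectation_other)
  ultimately show ?case using G'(1) by blast
qed

text \<open>When all coordinates are averaged out, \<open>G\<close> is constant, hence equal to the
  mean of \<open>F\<close>, and the left-hand side of the averaging bound becomes the
  entropy.\<close>

lemma fun_entropy_tensorization:
  assumes F: "pos_bdd_meas (PiM I M) F"
  shows "fun_entropy (PiM I M) F \<le> (\<Sum>k\<in>I. LINT x|PiM I M. coord_entropy k F x)"
proof -
  obtain G where G: "\<And>k. k \<in> I \<Longrightarrow> coord_indep I M k G"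
      "(LINT x|PiM I M. G x) = (LINT x|PiM I M. F x)"
      "(LINT x|PiM I M. F x * ln (F x)) - (LINT x|PiM I M. F x * ln (G x))
        \<le> (\<Sum>k\<in>I. LINT x|PiM I M. coord_entropy k F x)"
    using entropy_averaging[OF F order_refl] by auto
  obtain x0 where x0: "x0 \<in> space (PiM I M)" using not_empty by blast
  have c: "G x = G x0" if "x \<in> space (PiM I M)" for x
    using coord_indep_all_imp_const[OF G(1) that x0] .
  then have "(LINT x|PiM I M. G x) = (LINT x|PiM I M. G x0)"
    by (intro Bochner_Integration.integral_cong) auto
  then have "G x0 = (LINT x|PiM I M. F x)" using G(2) by (simp add: prob_space)
  moreover have "(LINT x|PiM I M. F x * ln (G x)) = (LINT x|PiM I M. F x * ln (G x0))"
    by (rule Bochner_Integration.integral_cong) (auto simp: c)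
  ultimately show ?thesis using G(3) by (simp add: fun_entropy_def)
qed

end

section \<open>Concentration\<close>

text \<open>The two contributions containing \<open>ln c\<close> cancel. This strips off the factor
  that is constant along a coordinate.\<close>

lemma fun_entropy_scale:
  assumes c: "c > 0" and F: "pos_bdd_meas M F" and M: "prob_space M"
  shows "fun_entropy M (\<lambda>x. c * F x) = c * fun_entropy M F"
proof -
  interpret prob_space M by fact
  note b = pos_bdd_meas_bdd[OF F]
  have m: "(LINT x|M. F x) > 0" using F by (rule integral_pos_bdd_meas)
  have "(LINT x|M. c * F x * ln (c * F x)) = (LINT x|M. c * ln c * F x + c * (F x * ln (F x)))"
    using c pos_bdd_meas_pos[OF F]
    by (intro Bochner_Integration.integral_cong) (auto simp: ln_mult algebra_simps)
  also have "\<dots> = c * ln c * (LINT x|M. F x) + c * (LINT x|M. F x * ln (F x))"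
    using b F by (simp add: integrable_bdd_meas bdd_meas_intros)
  finally show ?thesis using c m by (simp add: fun_entropy_def ln_mult algebra_simps)
qed

text \<open>The essential supremum lies between 0 and a finite bound, so the conversion to a real
  number never meets an infinite value.\<close>

lemma (in prob_space) AE_abs_le_Linf_norm:
  assumes "bdd_meas M g"
  shows "AE x in M. \<bar>g x\<bar> \<le> Linf_norm M g"
proof -
  obtain B where B: "\<And>x. x \<in> space M \<Longrightarrow> \<bar>g x\<bar> \<le> B" using assms by (metis bdd_measE)
  let ?e = "esssup M (\<lambda>x. ereal \<bar>g x\<bar>)"
  have m: "(\<lambda>x. ereal \<bar>g x\<bar>) \<in> borel_measurable M"
    using bdd_meas_measurable[OF assms] by measurable
  have "?e \<le> ereal B" using m B by (intro esssup_I) auto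
  moreover have "esssup M (\<lambda>x. 0 :: ereal) = 0"
    using emeasure_space_1 by (intro esssup_const) simp
  moreover have "esssup M (\<lambda>x. 0 :: ereal) \<le> ?e" by (intro esssup_mono) auto
  ultimately have "0 \<le> ?e" "?e \<le> ereal B" by simp_all
  then have "ereal (Linf_norm M g) = ?e"
    unfolding Linf_norm_def by (cases ?e) auto
  then show ?thesis using esssup_AE[of "\<lambda>x. ereal \<bar>g x\<bar>" M]
    by (simp flip: \<open>ereal (Linf_norm M g) = ?e\<close>)
qed

lemma (in finite_prob_product) coord_inf_le:
  assumes f: "bdd_meas (PiM I M) f" and k: "k \<in> I" and x: "x \<in> space (PiM I M)"
    and y: "y \<in> space (M k)"
  shows "coord_inf M k f x \<le> f (x(k := y))"
proof -
  obtain B where "\<And>x. x \<in> space (PiM I M) \<Longrightarrow> \<bar>f x\<bar> \<le> B" using f by (metis bdd_measE)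
  then have "- B \<le> f (x(k := z))" if "z \<in> space (M k)" for z
    using upd_space[OF x k that] by (meson abs_le_D2 minus_le_iff)
  then show ?thesis
    \<comment> \<open>The lower bound on \<open>f\<close> is essential: a real infimum is a lower
      bound only of sets that are bounded below.\<close>
    unfolding coord_inf_def using y by (intro cINF_lower bdd_belowI2[where m="- B"]) auto
qed

lemma (in finite_prob_product) coord_inf_le_self:
  assumes f: "bdd_meas (PiM I M) f" and k: "k \<in> I" and x: "x \<in> space (PiM I M)"
  shows "coord_inf M k f x \<le> f x"
  using coord_inf_le[OF f k x, of "x k"] k x by (auto simp: space_PiM)

lemma (in finite_prob_product) bdd_meas_coord_inf:
  assumes f: "bdd_meas (PiM I M) f" and k: "k \<in> I"
    and m: "coord_inf M k f \<in> borel_measurable (PiM I M)"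
  shows "bdd_meas (PiM I M) (coord_inf M k f)"
proof -
  interpret k: prob_space "M k" by (rule prob_M[OF k])
  obtain B where B: "\<And>x. x \<in> space (PiM I M) \<Longrightarrow> \<bar>f x\<bar> \<le> B" using f by (metis bdd_measE)
  show ?thesis
  proof (rule bdd_measI[OF m])
    fix x assume x: "x \<in> space (PiM I M)"
    have "- B \<le> f (x(k := y))" if "y \<in> space (M k)" for y
      using B[OF upd_space[OF x k that]] by linarith
    then have "- B \<le> coord_inf M k f x"
      unfolding coord_inf_def using k.not_empty by (intro cINF_greatest) auto
    then show "\<bar>coord_inf M k f x\<bar> \<le> B"
      using coord_inf_le_self[OF f k x] B[OF x] by linarith
  qed
qed

text \<open>An almost sure bound \<open>W\<close> suffices because it is applied only under the
  integral over the whole product.\<close>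

lemma (in finite_prob_product) lower_tail_mgf:
  assumes f: "bdd_meas (PiM I M) f"
    and meas_inf: "\<And>k. k \<in> I \<Longrightarrow> coord_inf M k f \<in> borel_measurable (PiM I M)"
    and b: "b > 0"
    and W: "AE x in PiM I M.
      (\<Sum>k\<in>I. coord_expectation M k (\<lambda>z. (f z - coord_inf M k f z)\<^sup>2) x) \<le> W"
  shows "(LINT x|PiM I M. exp (b * ((LINT z|PiM I M. f z) - f x))) \<le> exp (b\<^sup>2 / 2 * W)"
proof -
  define u where "u x = (LINT z|PiM I M. f z) - f x" for x
  define h where "h k x = f x - coord_inf M k f x" for k x
  define V where "V k = coord_expectation M k (\<lambda>z. (h k z)\<^sup>2)" for k
  have u: "bdd_meas (PiM I M) u" unfolding u_def[abs_def] using f by (intro bdd_meas_intros)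
  have h: "bdd_meas (PiM I M) (h k)" if "k \<in> I" for k
    unfolding h_def[abs_def] using f that meas_inf by (intro bdd_meas_diff bdd_meas_coord_inf)
  have h_nonneg: "0 \<le> h k x" if "k \<in> I" "x \<in> space (PiM I M)" for k x
    using coord_inf_le_self[OF f that] by (simp add: h_def)
  have V: "bdd_meas (PiM I M) (V k)" "coord_indep I M k (V k)" if "k \<in> I" for k
    unfolding V_def using h that
    by (auto intro!: bdd_meas_coord_expectation bdd_meas_power coord_indep_coord_expectation)
  have "fun_entropy (PiM I M) (\<lambda>x. exp (s * u x)) \<le> s\<^sup>2 / 2 * W * (LINT x|PiM I M. exp (s * u x))"
    if s: "s > 0" for s
  proof -
    let ?F = "\<lambda>x. exp (s * u x)"
    have F: "pos_bdd_meas (PiM I M) ?F" using u by (intro bdd_meas_intros)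
    note bF = pos_bdd_meas_bdd[OF F]
    have ent: "coord_entropy k ?F x \<le> s\<^sup>2 / 2 * (V k x * coord_expectation M k ?F x)"
      if k: "k \<in> I" and x: "x \<in> space (PiM I M)" for k x
    proof -
      interpret k: prob_space "M k" by (rule prob_M[OF k])
      let ?h = "\<lambda>y. h k (x(k := y))"
      \<comment> \<open>The infimum over coordinate \<open>k\<close> is unchanged by replacing that
        coordinate, so \<open>c\<close> is constant along it and homogeneity of entropy removes
        it.\<close>
      define c where "c = exp (s * ((LINT z|PiM I M. f z) - coord_inf M k f x))"
      have c: "c > 0" by (simp add: c_def)
      have hk: "bdd_meas (M k) ?h" using h k x by (intro bdd_meas_section)
      have Fc: "?F (x(k := y)) = c * exp (- s * ?h y)" for y
        by (simp add: u_def h_def c_def coord_inf_def algebra_simps flip: exp_add)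
      have "coord_entropy k ?F x = c * fun_entropy (M k) (\<lambda>y. exp (- s * ?h y))"
        unfolding coord_entropy_def Fc
        using c hk k.prob_space_axioms by (intro fun_entropy_scale bdd_meas_intros)
      also have "\<dots> \<le> c * (s\<^sup>2 / 2 * (LINT y|M k. (?h y)\<^sup>2) * (LINT y|M k. exp (- s * ?h y)))"
        using c hk s h_nonneg[OF k] upd_space[OF x k]
        by (intro mult_left_mono k.fun_entropy_exp_le) auto
      also have "\<dots> = s\<^sup>2 / 2 * (V k x * coord_expectation M k ?F x)"
        unfolding coord_expectation_def V_def Fc by simp
      finally show ?thesis .
    qed
    have i: "integrable (PiM I M) (\<lambda>x. V k x * ?F x)" if "k \<in> I" for k
      using V[OF that] bF by (intro integrable_bdd_meas bdd_meas_mult)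
    have "fun_entropy (PiM I M) ?F \<le> (\<Sum>k\<in>I. LINT x|PiM I M. coord_entropy k ?F x)"
      by (rule fun_entropy_tensorization[OF F])
    also have "\<dots> \<le> (\<Sum>k\<in>I. LINT x|PiM I M. s\<^sup>2 / 2 * (V k x * coord_expectation M k ?F x))"
      using V F bF ent
      by (intro sum_mono integral_mono integrable_bdd_meas bdd_meas_coord_entropy bdd_meas_mult
          bdd_meas_const bdd_meas_coord_expectation) auto
    also have "\<dots> = s\<^sup>2 / 2 * (\<Sum>k\<in>I. LINT x|PiM I M. V k x * coord_expectation M k ?F x)"
      by (simp add: sum_distrib_left)
    \<comment> \<open>\<open>V k\<close> is independent of coordinate \<open>k\<close>, so the
      partial expectation of the exponential can be undone. All summands then share one factor and
      the \<open>V k\<close> can be added.\<close>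
    also have "(\<Sum>k\<in>I. LINT x|PiM I M. V k x * coord_expectation M k ?F x)
        = (\<Sum>k\<in>I. LINT x|PiM I M. V k x * ?F x)"
      using V bF by (intro sum.cong refl integral_mult_coord_expectation) auto
    also have "\<dots> = (LINT x|PiM I M. (\<Sum>k\<in>I. V k x * ?F x))"
      using i by (simp add: Bochner_Integration.integral_sum)
    also have "\<dots> \<le> (LINT x|PiM I M. W * ?F x)"
    proof (rule integral_mono_AE)
      show "AE x in PiM I M. (\<Sum>k\<in>I. V k x * ?F x) \<le> W * ?F x"
        using W unfolding V_def h_def sum_distrib_right[symmetric]
        by eventually_elim (rule mult_right_mono, auto)
    qed (use i bF in \<open>auto intro!: integrable_bdd_meas\<close>)
    finally show ?thesis by (simp add: mult.assoc mult_left_mono)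
  qed
  from herbst[OF u this b]
  have "(LINT x|PiM I M. exp (b * u x)) \<le> exp (b * (LINT x|PiM I M. u x) + b\<^sup>2 / 2 * W)" .
  \<comment> \<open>\<open>u\<close> is centred, so the linear term in Herbst's bound
    vanishes.\<close>
  moreover have "(LINT x|PiM I M. u x) = 0"
    unfolding u_def using integrable_bdd_meas[OF f]
    by (simp add: prob_space)
  ultimately show ?thesis by (simp add: u_def)
qed

text \<open>Markov's inequality in exponential form: the indicator is at most
  \<open>exp (b * (u x - t))\<close> at every point.\<close>

lemma (in prob_space) chernoff_bound:
  assumes u: "bdd_meas M u" and b: "b > 0"
  shows "measure M {x \<in> space M. u x > t} \<le> (LINT x|M. exp (b * u x)) / exp (b * t)"
proof -
  have [measurable]: "u \<in> borel_measurable M" using u by (rule bdd_meas_measurable)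
  have A: "{x \<in> space M. u x > t} \<in> sets M" by measurable
  have e: "integrable M (\<lambda>x. exp (b * u x))"
    using u by (intro integrable_bdd_meas bdd_meas_intros)
  have "measure M {x \<in> space M. u x > t} = (LINT x|M. indicator {x \<in> space M. u x > t} x)"
    using A by simp
  also have "\<dots> \<le> (LINT x|M. exp (b * u x) / exp (b * t))"
  proof (rule integral_mono)
    fix x
    show "indicator {x \<in> space M. u x > t} x \<le> exp (b * u x) / exp (b * t)"
      using b by (auto simp: indicator_def simp flip: exp_diff right_diff_distrib)
  qed (use A e in \<open>auto simp: emeasure_eq_measure\<close>)
  finally show ?thesis by simp
qed

theorem theorem14:
  fixes n :: nat
    and M :: "nat \<Rightarrow> 'a measure"
    and \<mu> :: "(nat \<Rightarrow> 'a) measure"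
    and f :: "(nat \<Rightarrow> 'a) \<Rightarrow> real"
    and t W :: real
  assumes "\<And>k. k \<in> {1..n} \<Longrightarrow> prob_space (M k)"
    and "\<mu> = PiM {1..n} M"
    and "f \<in> borel_measurable \<mu>"
    and "bounded (f ` space \<mu>)"
    and "\<And>k. k \<in> {1..n} \<Longrightarrow> coord_inf M k f \<in> borel_measurable \<mu>"
    and "t > 0"
    and "W = Linf_norm \<mu>
      (\<lambda>x. \<Sum>k=1..n. coord_expectation M k (\<lambda>z. (f z - coord_inf M k f z)\<^sup>2) x)"
  shows "measure \<mu> {x \<in> space \<mu>. (LINT z|\<mu>. f z) - f x > t}
    \<le> (if W = 0 then 0 else exp (- t\<^sup>2 / (2 * W)))"
proof -
  interpret finite_prob_product "{1..n}" M
    by (rule finite_prob_product.intro[OF finite_atLeastAtMost assms(1)])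
  note [simp] = assms(2)
  let ?S = "\<lambda>x. \<Sum>k=1..n. coord_expectation M k (\<lambda>z. (f z - coord_inf M k f z)\<^sup>2) x"
  let ?P = "measure \<mu> {x \<in> space \<mu>. (LINT z|\<mu>. f z) - f x > t}"
  obtain B where "\<forall>y\<in>f ` space \<mu>. norm y \<le> B"
    using assms(4) unfolding bounded_iff by blast
  then have f: "bdd_meas (PiM {1..n} M) f"
    using assms(3) by (intro bdd_measI[where B=B]) auto
  have u: "bdd_meas (PiM {1..n} M) (\<lambda>x. (LINT z|\<mu>. f z) - f x)"
    using f by (intro bdd_meas_intros)
  have "bdd_meas (PiM {1..n} M) ?S"
    using bdd_meas_coord_inf[OF f] assms(5) f
    by (intro bdd_meas_sum bdd_meas_coord_expectation bdd_meas_power bdd_meas_diff) auto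
  then have AE_abs: "AE x in PiM {1..n} M. \<bar>?S x\<bar> \<le> W"
    using AE_abs_le_Linf_norm assms(7) by simp
  \<comment> \<open>An inequality between constants that holds almost surely in a probability space
    is true.\<close>
  then have "AE x in PiM {1..n} M. 0 \<le> W" by eventually_elim linarith
  then have "0 \<le> W" by simp
  have AE_S: "AE x in PiM {1..n} M. ?S x \<le> W" using AE_abs by eventually_elim linarith
  have bound: "?P \<le> exp (b\<^sup>2 / 2 * W - b * t)" if "b > 0" for b
  proof -
    have "?P \<le> (LINT x|\<mu>. exp (b * ((LINT z|\<mu>. f z) - f x))) / exp (b * t)"
      using chernoff_bound[OF u that] by simp
    also have "\<dots> \<le> exp (b\<^sup>2 / 2 * W) / exp (b * t)"
      using lower_tail_mgf[OF f _ that AE_S] assms(5) by (intro divide_right_mono) auto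
    finally show ?thesis by (simp add: exp_diff)
  qed
  show ?thesis
  proof (cases "W = 0")
    case True
    \<comment> \<open>Division by 0 would turn the exponential formula into the trivial bound 1. The
      bound 0 comes from letting \<open>b\<close> tend to infinity.\<close>
    have "((\<lambda>b. exp (- (b * t))) \<longlongrightarrow> 0) at_top"
      using \<open>t > 0\<close> by real_asymp
    moreover have "\<forall>\<^sub>F b in at_top. ?P \<le> exp (- (b * t))"
      using eventually_gt_at_top[of 0] by eventually_elim (use bound True in auto)
    ultimately have "?P \<le> 0" by (intro tendsto_lowerbound) auto
    then show ?thesis using True by simp
  next
    case False
    then have W: "W > 0" using \<open>0 \<le> W\<close> by simp
    \<comment> \<open>\<open>b = t / W\<close> minimises the exponent
      \<open>b\<^sup>2 / 2 * W - b * t\<close>.\<close>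
    have "(t / W)\<^sup>2 / 2 * W - t / W * t = - t\<^sup>2 / (2 * W)"
      using W by (simp add: field_simps power2_eq_square)
    then show ?thesis using bound[of "t / W"] W \<open>t > 0\<close> False by simp
  qed
qed

end
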